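(* Let $\mathfrak{a}$ be a finite-dimensional Lie algebra over a field of prime characteristic. Then every essential extension of a locally finite $\mathfrak{a}$-module is locally finite.
   Context: An $\mathfrak{a}$-module is the same as a unital $U(\mathfrak{a})$-module, where $U(\mathfrak{a})$ is the universal enveloping algebra. A module is locally finite if every finitely generated (equivalently, every cyclic) submodule is finite-dimensional over the ground field. A module $E$ containing $M$ as a submodule is an essential extension of $M$ if every non-zero submodule of $E$ intersects $M$ non-trivially. *)

theory Defs
  imports Complex_Main "HOL-Computational_Algebra.Primes"
begin

definition (in vector_space) finite_dim :: "'b set \<Rightarrow> bool" where
  "finite_dim V \<longleftrightarrow> (\<exists>B. finite B \<and> span B = V)"

(* The bracket is required to be alternating and not merely antisymmetric; the two
   notions differ in characteristic 2. *)
locale lie_algebra = vector_space scale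
  for scale :: "'k::field \<Rightarrow> 'a::ab_group_add \<Rightarrow> 'a" +
  fixes bracket :: "'a \<Rightarrow> 'a \<Rightarrow> 'a"
  assumes linear_bracket_right: "Vector_Spaces.linear scale scale (\<lambda>y. bracket x y)"
    and linear_bracket_left: "Vector_Spaces.linear scale scale (\<lambda>x. bracket x y)"
    and bracket_self: "bracket x x = 0"
    and jacobi: "bracket x (bracket y z) + bracket y (bracket z x) + bracket z (bracket x y) = 0"

(* The last axiom says that x \<mapsto> act x is a Lie algebra homomorphism into the
   endomorphisms of the vector space 'e with the commutator bracket, i.e. that it
   extends to a unital module structure over the universal enveloping algebra. *)
locale lie_module = A: lie_algebra scaleA bracket + E: vector_space scaleE
  for scaleA :: "'k::field \<Rightarrow> 'a::ab_group_add \<Rightarrow> 'a"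
    and bracket :: "'a \<Rightarrow> 'a \<Rightarrow> 'a"
    and scaleE :: "'k \<Rightarrow> 'e::ab_group_add \<Rightarrow> 'e" +
  fixes act :: "'a \<Rightarrow> 'e \<Rightarrow> 'e"
  assumes linear_act_right: "Vector_Spaces.linear scaleE scaleE (\<lambda>m. act x m)"
    and linear_act_left: "Vector_Spaces.linear scaleA scaleE (\<lambda>x. act x m)"
    and act_bracket: "act (bracket x y) m = act x (act y m) - act y (act x m)"
begin

definition submodule :: "'e set \<Rightarrow> bool" where
  "submodule N \<longleftrightarrow> E.subspace N \<and> (\<forall>x. \<forall>m\<in>N. act x m \<in> N)"

definition finitely_generated :: "'e set \<Rightarrow> bool" where
  "finitely_generated N \<longleftrightarrow> (\<exists>S. finite S \<and> N = submodule hull S)"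

definition locally_finite :: "'e set \<Rightarrow> bool" where
  "locally_finite M \<longleftrightarrow>
     (\<forall>N. submodule N \<and> N \<subseteq> M \<and> finitely_generated N \<longrightarrow> E.finite_dim N)"

definition essential_extension :: "'e set \<Rightarrow> 'e set \<Rightarrow> bool" where
  "essential_extension F M \<longleftrightarrow> submodule F \<and> submodule M \<and> M \<subseteq> F \<and>
     (\<forall>N. submodule N \<and> N \<subseteq> F \<and> N \<noteq> {0} \<longrightarrow> N \<inter> M \<noteq> {0})"

end

end

theory Submission
  imports Defs "HOL-Library.Function_Algebras"
begin

text \<open>
  Let \<open>C\<close> be a finitely generated submodule of the essential extension; it must be shown that
  \<open>C\<close> has finite dimension.

  In characteristic \<open>p\<close> the enveloping algebra is a finite module over a central polynomial ring
  (Jacobson). Indeed the \<open>p\<close>-power of a derivation is again a derivation, so the operator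
  \<open>X = act x\<close> satisfies \<open>[X^(p^i), act y] = act ((ad x)^(p^i) y)\<close>. The operators \<open>(ad x)^(p^i)\<close> live in
  a finite-dimensional space, hence some \<open>(ad x)^(p^m)\<close> is a linear combination of the earlier ones,
  and the same combination of the powers \<open>X^(p^i)\<close> gives a monic polynomial \<open>z\<^sub>x\<close> in \<open>X\<close> that commutes with
  the whole action (\<open>central_polynomial\<close>). Letting \<open>x\<close> run over a finite spanning set, \<open>C\<close> is generated
  over the commuting operators \<open>z\<^sub>x\<close> by a finite-dimensional space (\<open>hull_subset_of_stable\<close>), so by the
  argument of Hilbert's basis theorem it is Noetherian over them (\<open>noetherian_stable_superset\<close>).

  It remains to see that every \<open>z\<^sub>x\<close> is algebraic on \<open>C\<close> (\<open>central_operator_algebraic\<close>). As \<open>C\<close> is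
  Noetherian, \<open>C \<inter> M\<close> is finitely generated, hence of finite dimension, and so some monic polynomial
  \<open>t\<close> in \<open>z\<^sub>x\<close> kills it. The kernels of the powers of \<open>t\<close> on \<open>C\<close> stabilise, say at \<open>n\<close>. If \<open>t^n c\<close> lies in
  \<open>M\<close>, then \<open>t^(n+1) c = 0\<close> and therefore \<open>t^n c = 0\<close>: the submodule \<open>t^n C\<close> meets \<open>M\<close> trivially, and
  essentiality yields \<open>t^n C = 0\<close>. A space that is generated by a finite-dimensional one over finitely
  many commuting algebraic operators has finite dimension (\<open>finite_dim_stable_superset\<close>).
\<close>

section \<open>Linear dependence in a finite-dimensional space\<close>

context vector_space
begin

lemma subspace_Union_chain:
  assumes sub: "\<And>i::nat. subspace (F i)" and chain: "\<And>i. F i \<subseteq> F (Suc i)"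
  shows "subspace (\<Union>i. F i)"
proof (rule subspaceI)
  have mono: "F i \<subseteq> F j" if "i \<le> j" for i j
    using chain that by (rule lift_Suc_mono_le)
  show "0 \<in> (\<Union>i. F i)" using subspace_0[OF sub] by blast
  show "x + y \<in> (\<Union>i. F i)" if xy: "x \<in> (\<Union>i. F i)" "y \<in> (\<Union>i. F i)" for x y
  proof -
    from xy obtain i j where "x \<in> F i" "y \<in> F j" by blast
    then have "x \<in> F (max i j)" "y \<in> F (max i j)"
      using mono by (meson max.cobounded1 max.cobounded2 subsetD)+
    then show ?thesis using subspace_add[OF sub] by blast
  qed
  show "scale c x \<in> (\<Union>i. F i)" if "x \<in> (\<Union>i. F i)" for c x
    using that subspace_scale[OF sub] by blast
qed

lemma span_image_lessThan:
  assumes "x \<in> span (u ` {..<m::nat})"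
  shows "\<exists>c. x = (\<Sum>i<m. scale (c i) (u i))"
  using assms
proof (induction m arbitrary: x)
  case 0
  then show ?case by simp
next
  case (Suc m)
  have "x \<in> span (insert (u m) (u ` {..<m}))"
    using Suc.prems by (simp add: lessThan_Suc)
  then obtain k where "x - scale k (u m) \<in> span (u ` {..<m})"
    using span_breakdown_eq by blast
  from Suc.IH[OF this] obtain c where c: "x - scale k (u m) = (\<Sum>i<m. scale (c i) (u i))"
    by blast
  have "x = (\<Sum>i<Suc m. scale ((c(m := k)) i) (u i))"
    using c by (simp add: algebra_simps)
  then show ?case by blast
qed

lemma sequence_dependent:
  assumes "finite B" and u: "\<And>i::nat. u i \<in> span B"
  shows "\<exists>m c. u m = (\<Sum>i<m. scale (c i) (u i))"
proof -
  have "\<exists>m. u m \<in> span (u ` {..<m})"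
  proof (rule ccontr)
    assume "\<not> ?thesis"
    then have new: "u m \<notin> span (u ` {..<m})" for m by blast
    have "independent (u ` {..<m}) \<and> card (u ` {..<m}) = m" for m
    proof (induction m)
      case 0
      show ?case by (simp add: independent_empty)
    next
      case (Suc m)
      have "u m \<notin> u ` {..<m}" using new[of m] by (rule contrapos_nn) (rule span_base)
      then show ?case using Suc new[of m]
        by (simp add: lessThan_Suc independent_insertI)
    qed
    then have ind: "independent (u ` {..<Suc (card B)})"
      and card: "card (u ` {..<Suc (card B)}) = Suc (card B)" by blast+
    have "u ` {..<Suc (card B)} \<subseteq> span B" using u by blast
    with independent_span_bound[OF assms(1) ind] have "card (u ` {..<Suc (card B)}) \<le> card B"
      by blast
    then show False unfolding card by simp
  qed
  then obtain m where "u m \<in> span (u ` {..<m})" by blast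
  from span_image_lessThan[OF this] show ?thesis by blast
qed

text \<open>
  The point is that one choice of \<open>m\<close> and \<open>c\<close> serves all \<open>b\<close> in \<open>V\<close> at once. Restricted to \<open>V\<close>, the
  functions \<open>u i\<close> lie in a vector space of functions that is spanned by the finitely many functions
  supported at a single point of \<open>V\<close> and taking a value in \<open>B\<close>; \<open>sequence_dependent\<close> applies there.
\<close>

lemma common_dependence:
  assumes "finite B" "finite V" and u: "\<And>i b. b \<in> V \<Longrightarrow> u i b \<in> span B"
  shows "\<exists>(m::nat) c. \<forall>b\<in>V. u m b = (\<Sum>i<m. scale (c i) (u i b))"
proof -
  let ?sc = "\<lambda>c (f::'c \<Rightarrow> 'b) x. scale c (f x)"
  interpret F: vector_space ?sc
    by unfold_locales (auto simp: scale_right_distrib scale_left_distrib fun_eq_iff)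
  define unit where "unit = (\<lambda>(b::'c, b'::'b) x. if x = b then b' else 0)"
  define U where "U = (\<lambda>i x. if x \<in> V then u i x else 0)"
  have unit_span: "unit (b, y) \<in> F.span (unit ` (V \<times> B))" if "b \<in> V" "y \<in> span B" for b y
    using that(2)
  proof (induction rule: span_induct_alt)
    case base
    have "unit (b, 0) = 0" by (auto simp: unit_def fun_eq_iff)
    then show ?case by (metis F.span_zero)
  next
    case (step c x y)
    have "unit (b, scale c x + y) = ?sc c (unit (b, x)) + unit (b, y)"
      by (auto simp: unit_def fun_eq_iff)
    moreover have "unit (b, x) \<in> F.span (unit ` (V \<times> B))"
      using step that(1) by (intro F.span_base) auto
    ultimately show ?case using step by (metis F.span_add F.span_scale)
  qed
  have "U i \<in> F.span (unit ` (V \<times> B))" for i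
  proof -
    have "U i = (\<Sum>b\<in>V. unit (b, u i b))"
    proof
      fix x
      have "(\<Sum>b\<in>V. unit (b, u i b)) x = (\<Sum>b\<in>V. unit (b, u i b) x)"
        using assms(2) by induction auto
      also have "\<dots> = (\<Sum>b\<in>V. if x = b then u i b else 0)" by (simp add: unit_def)
      also have "\<dots> = U i x" using assms(2) by (simp add: U_def)
      finally show "U i x = (\<Sum>b\<in>V. unit (b, u i b)) x" by simp
    qed
    then show ?thesis using unit_span u by (auto intro: F.span_sum)
  qed
  then obtain m c where mc: "U m = (\<Sum>i<m. ?sc (c i) (U i))"
    using F.sequence_dependent[of "unit ` (V \<times> B)" U] assms by blast
  have "u m b = (\<Sum>i<m. scale (c i) (u i b))" if "b \<in> V" for b
  proof -
    have "(\<Sum>i<n. ?sc (c i) (U i)) b = (\<Sum>i<n. scale (c i) (U i b))" for n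
      by (induction n) auto
    with mc have "U m b = (\<Sum>i<m. scale (c i) (U i b))" by simp
    with that show ?thesis by (simp add: U_def)
  qed
  then show ?thesis by blast
qed

end

section \<open>Noetherian spaces of operators\<close>

text \<open>
  This locale adds nothing to \<open>vector_space\<close>. It keeps the notions below away from the real vector
  spaces, for which the base locale has a global interpretation under unqualified names.
\<close>

locale vector_space_operators = vector_space scale
  for scale :: "'k::field \<Rightarrow> 'b::ab_group_add \<Rightarrow> 'b"
begin

interpretation endo: vector_space_pair scale scale ..

abbreviation endomorphism :: "('b \<Rightarrow> 'b) \<Rightarrow> bool" where
  "endomorphism T \<equiv> Vector_Spaces.linear scale scale T"

lemma endomorphism_funpow:
  assumes "endomorphism T"
  shows "endomorphism (T ^^ n)"
proof (induction n)
  case 0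
  show ?case using linear_id by (simp add: id_def)
next
  case (Suc n)
  show ?case using Vector_Spaces.linear_compose[OF Suc assms] by (simp add: comp_def)
qed

definition stable :: "('b \<Rightarrow> 'b) set \<Rightarrow> 'b set \<Rightarrow> bool" where
  "stable Z L \<longleftrightarrow> subspace L \<and> (\<forall>z\<in>Z. \<forall>x\<in>L. z x \<in> L)"

text \<open>
  The ascending chain condition, in the form that an ascending chain cannot increase strictly at every
  step. This is equivalent to the usual form (\<open>noetherian_eventually_constant\<close>) and easier to prove
  in the base case and to apply.
\<close>

definition noetherian :: "('b \<Rightarrow> 'b) set \<Rightarrow> 'b set \<Rightarrow> bool" where
  "noetherian Z N \<longleftrightarrow>
     (\<forall>L. (\<forall>k::nat. stable Z (L k) \<and> L k \<subseteq> N \<and> L k \<subseteq> L (Suc k)) \<longrightarrow> (\<exists>m. L (Suc m) = L m))"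

lemma noetherian_subset:
  assumes "noetherian Z N" "N' \<subseteq> N"
  shows "noetherian Z N'"
  using assms unfolding noetherian_def by (meson subset_trans)

lemma noetherian_eventually_constant:
  assumes N: "noetherian Z N" and L: "\<And>k. stable Z (L k)" "\<And>k. L k \<subseteq> N" "\<And>k. L k \<subseteq> L (Suc k)"
  shows "\<exists>m. \<forall>k\<ge>m. L k = L m"
proof -
  have mono: "L i \<subseteq> L j" if "i \<le> j" for i j
    using lift_Suc_mono_le[of L i j] L(3) that by blast
  show ?thesis
  proof (rule ccontr)
    assume "\<not> ?thesis"
    then have "\<forall>m. \<exists>k\<ge>m. L k \<noteq> L m" by blast
    then obtain g where g: "g m \<ge> m" "L (g m) \<noteq> L m" for m by metis
    (* Skipping the stationary stretches turns the chain into one that moves at every step. *)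
    define J where "J = (\<lambda>m. L ((g ^^ m) 0))"
    have "J k \<subseteq> J (Suc k)" for k using mono[OF g(1)] by (simp add: J_def)
    moreover have "stable Z (J k)" "J k \<subseteq> N" for k using L by (simp_all add: J_def)
    ultimately have "\<exists>m. J (Suc m) = J m" by (intro N[unfolded noetherian_def, rule_format]) simp
    then obtain m where "J (Suc m) = J m" by (rule exE)
    then show False using g(2)[of "(g ^^ m) 0"] by (simp add: J_def)
  qed
qed

lemma noetherian_span_finite:
  assumes "finite B"
  shows "noetherian {} (span B)"
  unfolding noetherian_def
proof (intro allI impI, rule ccontr)
  fix L :: "nat \<Rightarrow> 'b set"
  assume L: "\<forall>k. stable {} (L k) \<and> L k \<subseteq> span B \<and> L k \<subseteq> L (Suc k)"
    and "\<nexists>m. L (Suc m) = L m"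
  then have "\<exists>x. x \<in> L (Suc m) \<and> x \<notin> L m" for m by blast
  then obtain u where u: "u m \<in> L (Suc m)" "u m \<notin> L m" for m by metis
  have "u i \<in> span B" for i using u(1) L by blast
  then obtain m c where "u m = (\<Sum>i<m. scale (c i) (u i))"
    using sequence_dependent[OF assms, of u] by blast
  moreover have "u i \<in> L m" if "i < m" for i
  proof -
    have "L (Suc i) \<subseteq> L m"
      by (rule lift_Suc_mono_le[of L]) (use L that in \<open>blast | simp\<close>)+
    with u(1)[of i] show ?thesis by (rule rev_subsetD)
  qed
  moreover have "subspace (L m)" using L by (simp add: stable_def)
  ultimately have "u m \<in> L m" by (auto intro!: subspace_sum subspace_scale)
  with u(2) show False by blast
qed

text \<open>
  The elements of \<open>N[T]\<close> of degree less than \<open>i\<close>, that is \<open>N + T N + \<dots> + T^(i-1) N\<close>. The sum is taken in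
  the ambient space and need not be direct, so the degree of a vector is only bounded, not determined.
\<close>

primrec power_sum :: "('b \<Rightarrow> 'b) \<Rightarrow> 'b set \<Rightarrow> nat \<Rightarrow> 'b set" where
  "power_sum T N 0 = {0}"
| "power_sum T N (Suc i) = {x + (T ^^ i) n | x n. x \<in> power_sum T N i \<and> n \<in> N}"

lemma subspace_power_sum:
  assumes "endomorphism T" "subspace N"
  shows "subspace (power_sum T N i)"
proof (induction i)
  case 0
  show ?case by (simp add: subspace_single_0)
next
  case (Suc i)
  have "subspace ((T ^^ i) ` N)"
    using assms endomorphism_funpow endo.linear_subspace_image by blast
  from subspace_sums[OF Suc this]
  have "subspace {x + y | x y. x \<in> power_sum T N i \<and> y \<in> (T ^^ i) ` N}" .
  also have "{x + y | x y. x \<in> power_sum T N i \<and> y \<in> (T ^^ i) ` N} = power_sum T N (Suc i)"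
    by auto
  finally show ?case .
qed

lemma power_sum_Suc:
  assumes "endomorphism T" "subspace N"
  shows "power_sum T N i \<subseteq> power_sum T N (Suc i)"
proof
  fix x assume "x \<in> power_sum T N i"
  moreover have "x = x + (T ^^ i) 0"
    using endo.linear_0[OF endomorphism_funpow[OF assms(1)]] by simp
  ultimately show "x \<in> power_sum T N (Suc i)"
    using subspace_0[OF assms(2)] unfolding power_sum.simps by blast
qed

lemma operator_power_sum:
  assumes "endomorphism T" "subspace N" "x \<in> power_sum T N i"
  shows "T x \<in> power_sum T N (Suc i)"
  using assms(3)
proof (induction i arbitrary: x)
  case 0
  then show ?case
    using subspace_0[OF subspace_power_sum[OF assms(1,2)], of "Suc 0"] endo.linear_0[OF assms(1)]
    by simp
next
  case (Suc i)
  then obtain y n where "x = y + (T ^^ i) n" "y \<in> power_sum T N i" "n \<in> N" by auto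
  moreover from this have "T y \<in> power_sum T N (Suc i)" using Suc.IH by blast
  ultimately show ?case by (subst power_sum.simps) (auto simp: endo.linear_add[OF assms(1)])
qed

lemma commuting_power_sum:
  assumes "endomorphism z" "\<And>x. z (T x) = T (z x)" "\<And>n. n \<in> N \<Longrightarrow> z n \<in> N"
    and "x \<in> power_sum T N i"
  shows "z x \<in> power_sum T N i"
proof -
  have comm: "z ((T ^^ j) y) = (T ^^ j) (z y)" for j y
    by (induction j) (simp_all add: assms(2))
  show ?thesis using assms(4)
  proof (induction i arbitrary: x)
    case 0
    then show ?case using endo.linear_0[OF assms(1)] by simp
  next
    case (Suc i)
    then obtain y n where "x = y + (T ^^ i) n" "y \<in> power_sum T N i" "n \<in> N" by auto
    then show ?case using Suc.IH assms(3)
      by (auto simp: endo.linear_add[OF assms(1)] comm)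
  qed
qed

lemma Union_power_sum_stable:
  assumes T: "endomorphism T" and Z: "\<And>z. z \<in> Z \<Longrightarrow> endomorphism z"
    and comm: "\<And>z x. z \<in> Z \<Longrightarrow> z (T x) = T (z x)" and N: "stable Z N"
  shows "stable (insert T Z) (\<Union>i. power_sum T N i)"
proof -
  have sub: "subspace N" using N by (simp add: stable_def)
  have "subspace (\<Union>i. power_sum T N i)"
    using subspace_power_sum[OF T sub] power_sum_Suc[OF T sub] by (rule subspace_Union_chain)
  moreover have "T x \<in> (\<Union>i. power_sum T N i)" if "x \<in> (\<Union>i. power_sum T N i)" for x
    using operator_power_sum[OF T sub] that by blast
  moreover have "z x \<in> (\<Union>i. power_sum T N i)"
    if z: "z \<in> Z" and x: "x \<in> (\<Union>i. power_sum T N i)" for z x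
  proof -
    from x obtain i where i: "x \<in> power_sum T N i" by blast
    have "z n \<in> N" if "n \<in> N" for n using N z that by (simp add: stable_def)
    from commuting_power_sum[OF Z[OF z] comm[OF z] this i] show ?thesis by blast
  qed
  ultimately show ?thesis unfolding stable_def by blast
qed

text \<open>
  The leading coefficients of the polynomials of degree \<open>i\<close> in \<open>L\<close>. Coefficients are not determined by
  the vector that they represent, so all of them are collected.
\<close>

definition leading :: "('b \<Rightarrow> 'b) \<Rightarrow> 'b set \<Rightarrow> 'b set \<Rightarrow> nat \<Rightarrow> 'b set" where
  "leading T N L i = {n \<in> N. \<exists>x \<in> power_sum T N i. x + (T ^^ i) n \<in> L}"

lemma leading_stable:
  assumes T: "endomorphism T" and Z: "\<And>z. z \<in> Z \<Longrightarrow> endomorphism z"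
    and comm: "\<And>z x. z \<in> Z \<Longrightarrow> z (T x) = T (z x)" and N: "stable Z N" and L: "stable Z L"
  shows "stable Z (leading T N L i)"
proof -
  have sub: "subspace N" "subspace L" using N L by (auto simp: stable_def)
  note P = subspace_power_sum[OF T sub(1), of i]
  note Ti = endomorphism_funpow[OF T, of i]
  have "subspace (leading T N L i)"
  proof (rule subspaceI)
    show "0 \<in> leading T N L i"
      using subspace_0[OF P] subspace_0[OF sub(1)] subspace_0[OF sub(2)] endo.linear_0[OF Ti]
      by (auto simp: leading_def intro!: bexI[of _ 0])
  next
    fix a b assume "a \<in> leading T N L i" "b \<in> leading T N L i"
    then obtain x y where *: "a \<in> N" "b \<in> N" "x \<in> power_sum T N i" "y \<in> power_sum T N i"
      "x + (T ^^ i) a \<in> L" "y + (T ^^ i) b \<in> L" by (auto simp: leading_def)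
    have "(x + y) + (T ^^ i) (a + b) = (x + (T ^^ i) a) + (y + (T ^^ i) b)"
      by (simp add: endo.linear_add[OF Ti] algebra_simps)
    also have "\<dots> \<in> L" using * subspace_add[OF sub(2)] by blast
    finally show "a + b \<in> leading T N L i"
      using * subspace_add[OF P] subspace_add[OF sub(1)] unfolding leading_def by blast
  next
    fix c a assume "a \<in> leading T N L i"
    then obtain x where *: "a \<in> N" "x \<in> power_sum T N i" "x + (T ^^ i) a \<in> L"
      by (auto simp: leading_def)
    have "scale c x + (T ^^ i) (scale c a) = scale c (x + (T ^^ i) a)"
      by (simp add: endo.linear_scale[OF Ti] scale_right_distrib)
    also have "\<dots> \<in> L" using * subspace_scale[OF sub(2)] by blast
    finally show "scale c a \<in> leading T N L i"
      using * subspace_scale[OF P] subspace_scale[OF sub(1)] unfolding leading_def by blast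
  qed
  moreover have "z a \<in> leading T N L i" if z: "z \<in> Z" and "a \<in> leading T N L i" for z a
  proof -
    from that(2) obtain x where *: "a \<in> N" "x \<in> power_sum T N i" "x + (T ^^ i) a \<in> L"
      by (auto simp: leading_def)
    have zN: "z n \<in> N" if "n \<in> N" for n using N z that by (simp add: stable_def)
    have pow: "z ((T ^^ j) y) = (T ^^ j) (z y)" for j y
      by (induction j) (simp_all add: comm[OF z])
    have "z x + (T ^^ i) (z a) = z (x + (T ^^ i) a)"
      by (simp add: endo.linear_add[OF Z[OF z]] pow)
    also have "\<dots> \<in> L" using * z L by (simp add: stable_def)
    finally show ?thesis
      using commuting_power_sum[OF Z[OF z] comm[OF z] zN *(2)] zN *(1)
      unfolding leading_def by blast
  qed
  ultimately show ?thesis by (simp add: stable_def)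
qed

lemma leading_Suc:
  assumes T: "endomorphism T" "subspace N" and L: "\<And>x. x \<in> L \<Longrightarrow> T x \<in> L"
  shows "leading T N L i \<subseteq> leading T N L (Suc i)"
proof
  fix a assume "a \<in> leading T N L i"
  then obtain x where *: "a \<in> N" "x \<in> power_sum T N i" "x + (T ^^ i) a \<in> L"
    by (auto simp: leading_def)
  have "T x + (T ^^ Suc i) a = T (x + (T ^^ i) a)"
    by (simp add: endo.linear_add[OF T(1)])
  also have "\<dots> \<in> L" using * L by blast
  finally show "a \<in> leading T N L (Suc i)"
    using operator_power_sum[OF T *(2)] *(1) unfolding leading_def by blast
qed

lemma leading_mono: "L \<subseteq> L' \<Longrightarrow> leading T N L i \<subseteq> leading T N L' i"
  unfolding leading_def by blast

text \<open>
  Subtracting an element of \<open>L\<close> with the same leading coefficient lowers the degree of an element of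
  \<open>L'\<close>.
\<close>

lemma eq_if_leading_eq:
  assumes T: "endomorphism T" "subspace N" and L: "subspace L" "subspace L'" "L \<subseteq> L'"
    and "L' \<subseteq> (\<Union>i. power_sum T N i)"
    and lead: "\<And>i. leading T N L' i = leading T N L i"
  shows "L' = L"
proof -
  have "y \<in> L" if "y \<in> L'" "y \<in> power_sum T N i" for y i
    using that
  proof (induction i arbitrary: y)
    case 0
    then show ?case using subspace_0[OF L(1)] by simp
  next
    case (Suc i)
    then obtain x n where y: "y = x + (T ^^ i) n" "x \<in> power_sum T N i" "n \<in> N" by auto
    with Suc.prems(1) have "n \<in> leading T N L' i" unfolding leading_def by blast
    then obtain x' where x': "x' \<in> power_sum T N i" "x' + (T ^^ i) n \<in> L"
      unfolding lead by (auto simp: leading_def)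
    have "x - x' = y - (x' + (T ^^ i) n)" by (simp add: y(1))
    also have "\<dots> \<in> L'" using Suc.prems(1) x'(2) L by (blast intro: subspace_diff)
    finally have "x - x' \<in> L"
      using Suc.IH subspace_diff[OF subspace_power_sum[OF T] y(2) x'(1)] by blast
    from subspace_add[OF L(1) this x'(2)] show ?case by (simp add: y(1))
  qed
  with assms(5,6) show ?thesis by blast
qed

text \<open>
  Hilbert's basis theorem for modules, with \<open>N\<close> in the role of the coefficients. The leading
  coefficients of degree \<open>i\<close> of the \<open>k\<close>-th member of a chain increase in \<open>i\<close> and in \<open>k\<close>. They are
  constant for \<open>i, k \<ge> m\<close> as soon as the diagonal is constant from \<open>m\<close> on, and each of the finitely many
  degrees below \<open>m\<close> stabilises by itself.
\<close>

lemma noetherian_Union_power_sum: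
  assumes T: "endomorphism T" and Z: "\<And>z. z \<in> Z \<Longrightarrow> endomorphism z"
    and comm: "\<And>z x. z \<in> Z \<Longrightarrow> z (T x) = T (z x)"
    and N: "stable Z N" "noetherian Z N"
  shows "noetherian (insert T Z) (\<Union>i. power_sum T N i)"
  unfolding noetherian_def
proof (intro allI impI)
  fix L :: "nat \<Rightarrow> 'b set"
  assume "\<forall>k. stable (insert T Z) (L k) \<and> L k \<subseteq> (\<Union>i. power_sum T N i) \<and> L k \<subseteq> L (Suc k)"
  then have L: "\<And>k. stable (insert T Z) (L k)" "\<And>k. L k \<subseteq> (\<Union>i. power_sum T N i)"
    "\<And>k. L k \<subseteq> L (Suc k)" by auto
  have sub: "subspace N" using N by (simp add: stable_def)
  have LZ: "stable Z (L k)" and LT: "\<And>x. x \<in> L k \<Longrightarrow> T x \<in> L k" and Lsub: "subspace (L k)" for k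
    using L(1)[of k] by (auto simp: stable_def)
  define P where "P k i = leading T N (L k) i" for k i
  have P_stable: "stable Z (P k i)" for k i
    unfolding P_def using leading_stable[OF T Z comm N(1) LZ] .
  have P_sub: "P k i \<subseteq> N" for k i by (auto simp: P_def leading_def)
  have P_left: "P k i \<subseteq> P k' i" if "k \<le> k'" for k k' i
    using leading_mono lift_Suc_mono_le[of L k k'] L(3) that unfolding P_def by blast
  have P_Suc: "P k i \<subseteq> P k (Suc i)" for k i
    unfolding P_def using leading_Suc[OF T sub LT] .
  have P_right: "P k i \<subseteq> P k i'" if "i \<le> i'" for k i i'
    using P_Suc that by (rule lift_Suc_mono_le)
  have "P k k \<subseteq> P (Suc k) (Suc k)" for k using P_left[of k "Suc k" k] P_Suc[of "Suc k" k] by simp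
  from noetherian_eventually_constant[of Z N "\<lambda>k. P k k", OF N(2) P_stable P_sub this]
  obtain m where m: "\<And>k. k \<ge> m \<Longrightarrow> P k k = P m m" by blast
  have "\<exists>g. \<forall>k\<ge>g. P k i = P g i" for i
    by (rule noetherian_eventually_constant[of Z N "\<lambda>k. P k i", OF N(2) P_stable P_sub P_left]) simp
  then obtain g where g: "\<And>i k. k \<ge> g i \<Longrightarrow> P k i = P (g i) i" by metis
  define M where "M = m + (\<Sum>i<m. g i)"
  have "P (Suc M) i = P M i" for i
  proof (cases "i < m")
    case True
    then have "g i \<le> M" using member_le_sum[of i "{..<m}" g] by (simp add: M_def)
    then show ?thesis using g[of i M] g[of i "Suc M"] by simp
  next
    case False
    have "P k i = P m m" if "k \<ge> m" for k
    proof
      have "P k i \<subseteq> P (max k i) (max k i)" using P_left P_right by (meson max.cobounded1 max.cobounded2 subset_trans)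
      with m[of "max k i"] that show "P k i \<subseteq> P m m" by simp
      have "P m m \<subseteq> P k i" using P_left[of m k m] P_right[of m i k] that False by (simp add: subset_trans)
      then show "P m m \<subseteq> P k i" .
    qed
    from this[of M] this[of "Suc M"] show ?thesis by (simp add: M_def)
  qed
  then have "L (Suc M) = L M"
    using eq_if_leading_eq[OF T sub Lsub Lsub L(3) L(2)] by (simp add: P_def)
  then show "\<exists>m. L (Suc m) = L m" by blast
qed

text \<open>
  Instead of computing the \<open>Z\<close>-stable space generated by \<open>B\<close>, it suffices to exhibit a larger
  Noetherian one, since the chain condition passes to subsets. It is built by adjoining the operators
  one at a time.
\<close>

lemma noetherian_stable_superset:
  assumes "finite Z" and Z: "\<And>z. z \<in> Z \<Longrightarrow> endomorphism z"
    and comm: "\<And>z z' x. z \<in> Z \<Longrightarrow> z' \<in> Z \<Longrightarrow> z (z' x) = z' (z x)" and "finite B"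
  shows "\<exists>N. span B \<subseteq> N \<and> stable Z N \<and> noetherian Z N"
  using assms(1) Z comm
proof (induction Z)
  case empty
  have "stable {} (span B)" by (simp add: stable_def)
  with noetherian_span_finite[OF assms(4)] show ?case by blast
next
  case (insert T Z)
  have "\<exists>N. span B \<subseteq> N \<and> stable Z N \<and> noetherian Z N"
    by (rule insert.IH) (use insert.prems in auto)
  then obtain N where N: "span B \<subseteq> N" "stable Z N" "noetherian Z N" by blast
  have T: "endomorphism T" and Z: "\<And>z. z \<in> Z \<Longrightarrow> endomorphism z"
    and comm: "\<And>z x. z \<in> Z \<Longrightarrow> z (T x) = T (z x)"
    using insert.prems by auto
  have "N \<subseteq> power_sum T N (Suc 0)" by auto
  with N(1) have "span B \<subseteq> (\<Union>i. power_sum T N i)" by blast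
  with Union_power_sum_stable[OF T Z comm N(2)] noetherian_Union_power_sum[OF T Z comm N(2,3)]
  show ?case by blast
qed

section \<open>Polynomials in an operator\<close>

lemma stable_span:
  assumes Z: "\<And>z. z \<in> Z \<Longrightarrow> endomorphism z" and B: "\<And>z b. z \<in> Z \<Longrightarrow> b \<in> B \<Longrightarrow> z b \<in> span B"
  shows "stable Z (span B)"
proof -
  have "z x \<in> span B" if z: "z \<in> Z" and x: "x \<in> span B" for z x
  proof -
    have "z ` span B = span (z ` B)" using endo.linear_span_image[OF Z[OF z]] by simp
    also have "\<dots> \<subseteq> span B" using B[OF z] by (intro span_minimal) auto
    finally show ?thesis using x by blast
  qed
  then show ?thesis by (simp add: stable_def)
qed

abbreviation powers_span :: "('b \<Rightarrow> 'b) \<Rightarrow> nat \<Rightarrow> 'b \<Rightarrow> 'b set" where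
  "powers_span T n x \<equiv> span ((\<lambda>i. (T ^^ i) x) ` {..<n})"

text \<open>
  If \<open>T\<close> has degree \<open>m\<close> on \<open>H\<close>, then adjoining \<open>T\<close> to a finite spanning set \<open>F\<close> only requires the
  vectors \<open>T^i b\<close> with \<open>b\<close> in \<open>F\<close> and \<open>i < m\<close>. Since \<open>T\<close> commutes with the operators adjoined before,
  the stability under them is not lost.
\<close>

lemma finite_dim_stable_superset:
  assumes "finite Z" and Z: "\<And>z. z \<in> Z \<Longrightarrow> endomorphism z"
    and comm: "\<And>z z' x. z \<in> Z \<Longrightarrow> z' \<in> Z \<Longrightarrow> z (z' x) = z' (z x)"
    and "finite B" "B \<subseteq> H" "stable Z H"
    and alg: "\<And>z. z \<in> Z \<Longrightarrow> \<exists>m. \<forall>x\<in>H. (z ^^ m) x \<in> powers_span z m x"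
  shows "\<exists>F. finite F \<and> F \<subseteq> H \<and> span B \<subseteq> span F \<and> stable Z (span F)"
  using assms(1) Z comm assms(6) alg
proof (induction Z)
  case empty
  have "stable {} (span B)" by (simp add: stable_def)
  then show ?case using assms(4,5) by blast
next
  case (insert T Z)
  have H: "stable Z H" using insert.prems(3) by (simp add: stable_def)
  have "\<exists>F. finite F \<and> F \<subseteq> H \<and> span B \<subseteq> span F \<and> stable Z (span F)"
    by (rule insert.IH) (use insert.prems H in auto)
  then obtain F where F: "finite F" "F \<subseteq> H" "span B \<subseteq> span F" "stable Z (span F)" by blast
  have T: "endomorphism T" and Z: "\<And>z. z \<in> Z \<Longrightarrow> endomorphism z"
    and comm: "\<And>z x. z \<in> Z \<Longrightarrow> z (T x) = T (z x)"
    using insert.prems by auto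
  have TH: "T x \<in> H" if "x \<in> H" for x using insert.prems(3) that by (simp add: stable_def)
  have TiH: "(T ^^ i) x \<in> H" if "x \<in> H" for x i using that by (induction i) (auto simp: TH)
  obtain m where m: "\<And>x. x \<in> H \<Longrightarrow> (T ^^ m) x \<in> powers_span T m x"
    using insert.prems(4)[of T] by auto
  define F' where "F' = (\<lambda>(i, b). (T ^^ i) b) ` ({..<m} \<times> F)"
  have low: "powers_span T m b \<subseteq> span F'" if "b \<in> F" for b
    using that by (intro span_mono) (auto simp: F'_def)
  have base: "(T ^^ i) b \<in> span F'" if "b \<in> F" "i \<le> m" for i b
  proof (cases "i = m")
    case True
    then show ?thesis using m low that F(2) by blast
  next
    case False
    with that show ?thesis by (intro span_base) (auto simp: F'_def)
  qed
  have "finite F'" using F(1) by (simp add: F'_def)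
  moreover have "F' \<subseteq> H" using F(2) TiH by (auto simp: F'_def)
  moreover have "span B \<subseteq> span F'"
  proof -
    have "span F \<subseteq> span F'" using base[of _ 0] by (intro span_minimal) auto
    with F(3) show ?thesis by blast
  qed
  moreover have "stable (insert T Z) (span F')"
  proof (rule stable_span)
    show "endomorphism z" if "z \<in> insert T Z" for z using that T Z by blast
    fix z y assume z: "z \<in> insert T Z" and "y \<in> F'"
    then obtain i b where y: "i < m" "b \<in> F" "y = (T ^^ i) b" by (auto simp: F'_def)
    show "z y \<in> span F'"
    proof (cases "z = T")
      case True
      then show ?thesis using base[of b "Suc i"] y by simp
    next
      case False
      with z have zZ: "z \<in> Z" by simp
      have pow: "z ((T ^^ j) x) = (T ^^ j) (z x)" for j x
        by (induction j) (simp_all add: comm[OF zZ])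
      have "z b \<in> span F" using F(4) zZ span_base[OF y(2)] by (simp add: stable_def)
      then have "(T ^^ i) (z b) \<in> span ((T ^^ i) ` F)"
        using endo.linear_span_image[OF endomorphism_funpow[OF T]] by blast
      also have "\<dots> \<subseteq> span F'" using y(1) by (intro span_mono) (auto simp: F'_def)
      finally show ?thesis by (simp add: y(3) pow)
    qed
  qed
  ultimately show ?case by blast
qed

text \<open>
  A monic polynomial in \<open>T\<close> that involves only the exponents \<open>e 0, \<dots>, e m\<close>. The choice \<open>e i = p ^ i\<close>
  gives the \<open>p\<close>-polynomials, the choice \<open>e i = i\<close> the ordinary ones.
\<close>

definition operator_poly :: "(nat \<Rightarrow> nat) \<Rightarrow> (nat \<Rightarrow> 'k) \<Rightarrow> nat \<Rightarrow> ('b \<Rightarrow> 'b) \<Rightarrow> 'b \<Rightarrow> 'b" where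
  "operator_poly e c m T x = (T ^^ e m) x - (\<Sum>i<m. scale (c i) ((T ^^ e i) x))"

lemma endomorphism_operator_poly:
  assumes "endomorphism T"
  shows "endomorphism (operator_poly e c m T)"
  unfolding operator_poly_def
  by (intro endo.linear_compose_sub endo.linear_compose_sum endo.linear_compose_scale_right ballI
      endomorphism_funpow assms)

lemma operator_poly_commute:
  assumes f: "endomorphism f" and comm: "\<And>x. f (T x) = T (f x)"
  shows "f (operator_poly e c m T x) = operator_poly e c m T (f x)"
proof -
  have "f ((T ^^ j) y) = (T ^^ j) (f y)" for j y
    by (induction j) (simp_all add: comm)
  then show ?thesis
    by (simp add: operator_poly_def endo.linear_diff[OF f] endo.linear_sum[OF f] endo.linear_scale[OF f])
qed

lemma operator_poly_leading:
  assumes "strict_mono e"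
  shows "operator_poly e c m T x - (T ^^ e m) x \<in> powers_span T (e m) x"
proof -
  have "e i < e m" if "i < m" for i using assms that by (simp add: strict_mono_def)
  then have "(\<Sum>i<m. scale (c i) ((T ^^ e i) x)) \<in> powers_span T (e m) x"
    by (intro span_sum span_scale span_base) auto
  then have "- (\<Sum>i<m. scale (c i) ((T ^^ e i) x)) \<in> powers_span T (e m) x" by (rule span_neg)
  then show ?thesis by (simp add: operator_poly_def)
qed

lemma operator_poly_mem:
  assumes "subspace L" "\<And>x. x \<in> L \<Longrightarrow> T x \<in> L" "x \<in> L"
  shows "operator_poly e c m T x \<in> L"
proof -
  have "(T ^^ j) x \<in> L" for j using assms(2,3) by (induction j) auto
  then show ?thesis unfolding operator_poly_def
    by (intro subspace_diff subspace_sum subspace_scale assms(1))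
qed

text \<open>
  A power of a monic polynomial is monic. Here an operator \<open>t\<close> counts as monic of degree \<open>d\<close> in \<open>T\<close>
  if, on every vector, it agrees with \<open>T^d\<close> up to lower powers of \<open>T\<close>.
\<close>

lemma leading_funpow:
  assumes t: "endomorphism t" and lead: "\<And>x. t x - (T ^^ d) x \<in> powers_span T d x"
  shows "(t ^^ n) x - (T ^^ (d * n)) x \<in> powers_span T (d * n) x"
proof (induction n)
  case 0
  show ?case by (simp add: span_zero)
next
  case (Suc n)
  have shift: "powers_span T d ((T ^^ i) y) \<subseteq> powers_span T (d + i) y" for i y
    by (intro span_mono) (auto simp flip: funpow_add comp_apply[of "T ^^ _" "T ^^ _"])
  have step: "t ((T ^^ i) y) - (T ^^ (d + i)) y \<in> powers_span T (d + i) y" for i y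
    using lead[of "(T ^^ i) y"] shift[of i y] by (auto simp: funpow_add)
  have mono: "powers_span T i y \<subseteq> powers_span T j y" if "i \<le> j" for i j y
    using that by (intro span_mono) auto
  have raise: "t y \<in> powers_span T (d + k) x" if y: "y \<in> powers_span T k x" for y k
  proof -
    have "t ((T ^^ i) x) \<in> powers_span T (d + k) x" if "i < k" for i
    proof -
      have "(T ^^ (d + i)) x \<in> powers_span T (d + k) x"
        using that by (intro span_base) auto
      moreover have "t ((T ^^ i) x) - (T ^^ (d + i)) x \<in> powers_span T (d + k) x"
        using step[of i x] mono[of "d + i" "d + k" x] that by auto
      ultimately have "(t ((T ^^ i) x) - (T ^^ (d + i)) x) + (T ^^ (d + i)) x \<in> powers_span T (d + k) x"
        by (intro span_add)
      then show ?thesis by simp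
    qed
    then have "span (t ` (\<lambda>i. (T ^^ i) x) ` {..<k}) \<subseteq> powers_span T (d + k) x"
      by (intro span_minimal) auto
    moreover have "t y \<in> span (t ` (\<lambda>i. (T ^^ i) x) ` {..<k})"
      using endo.linear_span_image[OF t] y by blast
    ultimately show ?thesis by blast
  qed
  have "t ((t ^^ n) x - (T ^^ (d * n)) x) + (t ((T ^^ (d * n)) x) - (T ^^ (d + d * n)) x)
      \<in> powers_span T (d + d * n) x"
    using raise[OF Suc] step by (rule span_add)
  then show ?case by (simp add: endo.linear_diff[OF t])
qed

end

section \<open>Central elements\<close>

context lie_module
begin

sublocale E: vector_space_operators scaleE ..

interpretation AE: vector_space_pair scaleA scaleE ..
interpretation EE: vector_space_pair scaleE scaleE ..

text \<open>
  Leibniz's rule: the hypothesis says that the commutator with \<open>X\<close> acts on the operators \<open>act y\<close> as the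
  derivation \<open>D\<close>.
\<close>

lemma derivation_power:
  assumes X: "E.endomorphism X" and D: "\<And>y u. X (act y u) = act (D y) u + act y (X u)"
  shows "(X ^^ m) (act y u) = (\<Sum>k\<le>m. scaleE (of_nat (m choose k)) (act ((D ^^ k) y) ((X ^^ (m - k)) u)))"
proof (induction m)
  case 0
  show ?case by simp
next
  case (Suc m)
  define g where "g k = act ((D ^^ k) y) ((X ^^ (Suc m - k)) u)" for k
  have step: "X (act ((D ^^ k) y) ((X ^^ (m - k)) u)) = g (Suc k) + g k" if "k \<le> m" for k
    using that by (simp add: D g_def Suc_diff_le)
  have "(X ^^ Suc m) (act y u) =
      (\<Sum>k\<le>m. scaleE (of_nat (m choose k)) (X (act ((D ^^ k) y) ((X ^^ (m - k)) u))))"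
    by (simp add: Suc EE.linear_sum[OF X] EE.linear_scale[OF X])
  also have "\<dots> = (\<Sum>k\<le>m. scaleE (of_nat (m choose k)) (g (Suc k) + g k))"
    using step by (intro sum.cong) auto
  also have "\<dots> = (\<Sum>k\<le>m. scaleE (of_nat (m choose k)) (g (Suc k)))
      + (\<Sum>k\<le>Suc m. scaleE (of_nat (m choose k)) (g k))"
    by (simp add: E.scale_right_distrib sum.distrib binomial_eq_0)
  also have "(\<Sum>k\<le>Suc m. scaleE (of_nat (m choose k)) (g k)) =
      g 0 + (\<Sum>k\<le>m. scaleE (of_nat (m choose Suc k)) (g (Suc k)))"
    by (subst sum.atMost_Suc_shift) simp
  also have "(\<Sum>k\<le>m. scaleE (of_nat (m choose k)) (g (Suc k))) + \<dots> =
      g 0 + (\<Sum>k\<le>m. scaleE (of_nat (Suc m choose Suc k)) (g (Suc k)))"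
    by (simp add: E.scale_left_distrib sum.distrib)
  also have "\<dots> = (\<Sum>k\<le>Suc m. scaleE (of_nat (Suc m choose k)) (g k))"
    by (subst sum.atMost_Suc_shift[of _ m]) simp
  finally show ?case by (simp add: g_def)
qed

text \<open>
  In Leibniz's rule for the \<open>p\<close>-th power all inner binomial coefficients vanish. The conclusion has the
  form of the hypothesis, with \<open>X^p\<close> and \<open>D^p\<close>, so the statement can be iterated.
\<close>

lemma derivation_power_char:
  assumes p: "prime p" "CHAR('k) = p"
    and X: "E.endomorphism X" and D: "\<And>y u. X (act y u) = act (D y) u + act y (X u)"
  shows "(X ^^ p) (act y u) = act ((D ^^ p) y) u + act y ((X ^^ p) u)"
proof -
  define g where "g k = scaleE (of_nat (p choose k)) (act ((D ^^ k) y) ((X ^^ (p - k)) u))" for k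
  have "g k = 0" if "k \<in> {..p} - {0, p}" for k
  proof -
    have "p dvd p choose k" using that p(1) by (intro dvd_choose_prime) auto
    then have "of_nat (p choose k) = (0::'k)" using p(2) by (simp add: of_nat_eq_0_iff_char_dvd)
    then show ?thesis by (simp add: g_def)
  qed
  then have "(\<Sum>k\<le>p. g k) = (\<Sum>k\<in>{0, p}. g k)"
    by (intro sum.mono_neutral_right) auto
  also have "\<dots> = act y ((X ^^ p) u) + act ((D ^^ p) y) u"
    using prime_gt_0_nat[OF p(1)] by (simp add: g_def)
  finally show ?thesis using derivation_power[OF X D, of p y u] by (simp add: g_def add.commute)
qed

lemma act_prime_power:
  assumes p: "prime p" "CHAR('k) = p"
  shows "(act x ^^ (p ^ i)) (act y u) = act ((bracket x ^^ (p ^ i)) y) u + act y ((act x ^^ (p ^ i)) u)"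
proof (induction i arbitrary: y u)
  case 0
  show ?case using act_bracket[of x y u] by simp
next
  case (Suc i)
  have "E.endomorphism (act x ^^ (p ^ i))" by (intro E.endomorphism_funpow linear_act_right)
  from derivation_power_char[OF p this Suc.IH, of y u] show ?case
    by (simp add: funpow_mult mult.commute)
qed

text \<open>
  By \<open>act_prime_power\<close>, the commutator of a \<open>p\<close>-polynomial in \<open>act x\<close> with \<open>act y\<close> is the action of the
  same \<open>p\<close>-polynomial in \<open>ad x\<close> applied to \<open>y\<close>. A \<open>p\<close>-polynomial that annihilates \<open>ad x\<close> therefore
  gives a central operator.
\<close>

lemma central_polynomial:
  assumes p: "prime p" "CHAR('k) = p" and B: "finite B" "A.span B = UNIV"
  shows "\<exists>m c. \<forall>y u. E.operator_poly ((^) p) c m (act x) (act y u) = act y (E.operator_poly ((^) p) c m (act x) u)"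
proof -
  obtain m c where mc: "\<And>b. b \<in> B \<Longrightarrow>
      (bracket x ^^ (p ^ m)) b = (\<Sum>i<m. scaleA (c i) ((bracket x ^^ (p ^ i)) b))"
    using A.common_dependence[OF B(1) B(1), of "\<lambda>i. bracket x ^^ (p ^ i)"] B(2) by auto
  interpret AA: vector_space_pair scaleA scaleA ..
  interpret AO: vector_space_operators scaleA ..
  have D: "AO.endomorphism (bracket x ^^ j)" for j
    by (intro AO.endomorphism_funpow A.linear_bracket_right)
  have "AO.endomorphism (\<lambda>y. \<Sum>i<m. scaleA (c i) ((bracket x ^^ (p ^ i)) y))"
    by (intro AA.linear_compose_sum AA.linear_compose_scale_right ballI D)
  from AA.linear_eq_on[OF D this _ mc] B(2)
  have mc: "(bracket x ^^ (p ^ m)) y = (\<Sum>i<m. scaleA (c i) ((bracket x ^^ (p ^ i)) y))" for y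
    by blast
  have "E.operator_poly ((^) p) c m (act x) (act y u) = act y (E.operator_poly ((^) p) c m (act x) u)"
    for y u
  proof -
    note l = linear_act_left[of u] and r = linear_act_right[of y]
    show ?thesis
      unfolding E.operator_poly_def act_prime_power[OF p] mc
      by (simp add: AE.linear_sum[OF l] AE.linear_scale[OF l] EE.linear_diff[OF r] EE.linear_sum[OF r]
          EE.linear_scale[OF r] E.scale_right_distrib sum.distrib)
  qed
  then show ?thesis by blast
qed

section \<open>Finitely generated modules over the central operators\<close>

lemma submoduleD: "submodule N \<Longrightarrow> E.subspace N" "submodule N \<Longrightarrow> m \<in> N \<Longrightarrow> act x m \<in> N"
  by (auto simp: submodule_def)

lemma submodule_hull: "submodule (submodule hull S)"
proof (rule hull_in)
  fix T assume "Ball T submodule"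
  then show "submodule (\<Inter>T)" unfolding submodule_def by (auto intro: E.subspace_Inter)
qed

text \<open>
  Letters come from a finite spanning set \<open>B\<close> of the Lie algebra, which makes the set finite. The strict
  length bound allows \<open>n = 0\<close> to stand for the zero space.
\<close>

definition words :: "'a set \<Rightarrow> 'e set \<Rightarrow> nat \<Rightarrow> 'e set" where
  "words B S n = {foldr act w s | w s. s \<in> S \<and> set w \<subseteq> B \<and> length w < n}"

abbreviation word_span :: "'a set \<Rightarrow> 'e set \<Rightarrow> nat \<Rightarrow> 'e set" where
  "word_span B S n \<equiv> E.span (words B S n)"

lemma wordsI: "s \<in> S \<Longrightarrow> set w \<subseteq> B \<Longrightarrow> length w < n \<Longrightarrow> foldr act w s \<in> words B S n"
  by (auto simp: words_def)

lemma finite_words: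
  assumes "finite B" "finite S"
  shows "finite (words B S n)"
proof -
  have "words B S n \<subseteq> (\<lambda>(w, s). foldr act w s) ` ({w. set w \<subseteq> B \<and> length w \<le> n} \<times> S)"
    by (auto simp: words_def intro!: image_eqI[of _ _ "(_, _)"])
  moreover have "finite ({w. set w \<subseteq> B \<and> length w \<le> n} \<times> S)"
    using assms finite_lists_length_le by blast
  ultimately show ?thesis by (meson finite_imageI finite_subset)
qed

lemma words_subset_submodule:
  assumes "submodule N" "S \<subseteq> N"
  shows "words B S n \<subseteq> N"
proof -
  have "foldr act w s \<in> N" if "s \<in> S" for w s
    using that assms by (induction w) (auto simp: submodule_def)
  then show ?thesis by (auto simp: words_def)
qed

lemma word_span_mono: "m \<le> n \<Longrightarrow> word_span B S m \<subseteq> word_span B S n"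
  by (intro E.span_mono) (fastforce simp: words_def)

lemma act_word_span:
  assumes B: "A.span B = UNIV" and u: "u \<in> word_span B S n"
  shows "act x u \<in> word_span B S (Suc n)"
proof -
  have gen: "act b u \<in> word_span B S (Suc n)" if b: "b \<in> B" for b
  proof -
    have "act b ` words B S n \<subseteq> words B S (Suc n)"
    proof
      fix y assume "y \<in> act b ` words B S n"
      then obtain w s where "s \<in> S" "set w \<subseteq> B" "length w < n" "y = foldr act (b # w) s"
        by (auto simp: words_def)
      with b show "y \<in> words B S (Suc n)" unfolding words_def
        by (intro CollectI exI[of _ "b # w"] exI[of _ s]) auto
    qed
    then have "E.span (act b ` words B S n) \<subseteq> word_span B S (Suc n)" by (rule E.span_mono)
    moreover have "act b u \<in> E.span (act b ` words B S n)"
      using EE.linear_span_image[OF linear_act_right[of b]] u by blast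
    ultimately show ?thesis by blast
  qed
  have "act x u \<in> E.span ((\<lambda>x. act x u) ` B)"
    using AE.linear_span_image[OF linear_act_left[of u], of B] B by auto
  also have "\<dots> \<subseteq> word_span B S (Suc n)"
    using gen by (intro E.span_minimal) auto
  finally show ?thesis .
qed

lemma act_power_word_span:
  assumes B: "A.span B = UNIV" and u: "u \<in> word_span B S n"
  shows "(act x ^^ k) u \<in> word_span B S (n + k)"
proof (induction k)
  case 0
  show ?case using u by simp
next
  case (Suc k)
  then show ?case using act_word_span[OF B] by simp
qed

lemma hull_subset_Union_word_span:
  assumes B: "A.span B = UNIV"
  shows "submodule hull S \<subseteq> (\<Union>n. word_span B S n)"
proof (rule hull_minimal)
  show "S \<subseteq> (\<Union>n. word_span B S n)"
  proof
    fix s assume "s \<in> S"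
    then have "s \<in> words B S 1" by (auto simp: words_def intro: exI[of _ "[]"])
    then show "s \<in> (\<Union>n. word_span B S n)" using E.span_base by blast
  qed
  have "E.subspace (\<Union>n. word_span B S n)"
    by (rule E.subspace_Union_chain) (simp_all add: word_span_mono)
  then show "submodule (\<Union>n. word_span B S n)"
    using act_word_span[OF B] unfolding submodule_def by blast
qed

text \<open>
  The enveloping algebra is commutative up to shorter words, because a commutator of two letters is a
  single letter.
\<close>

lemma act_power_commute_mod:
  assumes B: "A.span B = UNIV" and u: "u \<in> word_span B S n"
  shows "act y ((act x ^^ k) u) - (act x ^^ k) (act y u) \<in> word_span B S (n + k)"
proof (induction k)
  case 0
  show ?case by (simp add: E.span_zero)
next
  case (Suc k)
  let ?v = "(act x ^^ k) u"
  have "act x (act y ?v - (act x ^^ k) (act y u)) + act (bracket y x) ?v \<in> word_span B S (Suc (n + k))"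
    by (intro E.span_add act_word_span[OF B] Suc act_power_word_span[OF B] u)
  then show ?case
    by (simp add: act_bracket EE.linear_diff[OF linear_act_right])
qed

text \<open>
  Up to shorter words, all occurrences of the letter \<open>x\<close> in \<open>w\<close> can be moved to the front; \<open>r\<close> comes
  from the remaining letters, and \<open>j\<close> is their number.
\<close>

lemma collect_letter:
  assumes B: "A.span B = UNIV" and "s \<in> S" "set w \<subseteq> B"
  shows "\<exists>r j. length w = j + count_list w x \<and> r \<in> word_span B S (Suc j) \<and>
    foldr act w s - (act x ^^ count_list w x) r \<in> word_span B S (length w)"
  using assms(3)
proof (induction w)
  case Nil
  have "s \<in> word_span B S (Suc 0)"
    using wordsI[OF assms(2), of "[]" B "Suc 0"] by (simp add: E.span_base)
  then show ?case by (intro exI[of _ s] exI[of _ 0]) (simp add: E.span_zero)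
next
  case (Cons y w)
  then obtain r j where rj: "length w = j + count_list w x" "r \<in> word_span B S (Suc j)"
    "foldr act w s - (act x ^^ count_list w x) r \<in> word_span B S (length w)" by auto
  let ?d = "foldr act w s - (act x ^^ count_list w x) r"
  have d: "act y ?d \<in> word_span B S (Suc (length w))" by (rule act_word_span[OF B rj(3)])
  show ?case
  proof (cases "y = x")
    case True
    with d have "foldr act (y # w) s - (act x ^^ count_list (y # w) x) r
        \<in> word_span B S (length (y # w))"
      by (simp add: EE.linear_diff[OF linear_act_right])
    moreover have "length (y # w) = j + count_list (y # w) x" using rj(1) True by simp
    ultimately show ?thesis using rj(2) by blast
  next
    case False
    have "act y ?d + (act y ((act x ^^ count_list w x) r) - (act x ^^ count_list w x) (act y r))
        \<in> word_span B S (Suc (length w))"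
      using d act_power_commute_mod[OF B rj(2), of y "count_list w x" x] rj(1)
      by (intro E.span_add) auto
    with False have "foldr act (y # w) s - (act x ^^ count_list (y # w) x) (act y r)
        \<in> word_span B S (length (y # w))"
      by (simp add: EE.linear_diff[OF linear_act_right])
    moreover have "length (y # w) = Suc j + count_list (y # w) x" using rj(1) False by simp
    ultimately show ?thesis using act_word_span[OF B rj(2), of y] by blast
  qed
qed

text \<open>
  The module generated by \<open>S\<close> is generated over the operators \<open>z x\<close> by the words that are not too long.
  A longer word contains some letter \<open>x\<close> at least \<open>q x\<close> times. After moving these letters to the
  front, \<open>(act x)^(q x)\<close> may be replaced by \<open>z x\<close> up to lower powers of \<open>act x\<close>, and only shorter words
  are left.
\<close>

lemma hull_subset_of_stable:
  assumes B: "finite B" "A.span B = UNIV"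
    and q: "\<And>x. x \<in> B \<Longrightarrow> q x > 0"
    and lead: "\<And>x u. x \<in> B \<Longrightarrow> z x u - (act x ^^ q x) u \<in> E.powers_span (act x) (q x) u"
    and L: "E.stable (z ` B) L" "word_span B S (Suc (\<Sum>x\<in>B. q x)) \<subseteq> L"
  shows "submodule hull S \<subseteq> L"
proof -
  have sub: "E.subspace L" using L(1) by (simp add: E.stable_def)
  let ?D = "\<Sum>x\<in>B. q x"
  have "word_span B S n \<subseteq> L" for n
  proof (induction n)
    case 0
    show ?case using word_span_mono[of 0 "Suc ?D"] L(2) by blast
  next
    case (Suc n)
    show ?case
    proof (cases "n \<le> ?D")
      case True
      then show ?thesis using word_span_mono[of "Suc n" "Suc ?D"] L(2) by blast
    next
      case False
      have "words B S (Suc n) \<subseteq> L"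
      proof
        fix y assume "y \<in> words B S (Suc n)"
        then obtain w s where w: "s \<in> S" "set w \<subseteq> B" "length w < Suc n" "y = foldr act w s"
          by (auto simp: words_def)
        show "y \<in> L"
        proof (cases "length w = n")
          case False
          with w have "y \<in> words B S n" by (simp add: wordsI)
          then show ?thesis using Suc E.span_base by blast
        next
          case True
          (* Pigeonhole: otherwise the length n of w would be at most the sum of the q x. *)
          have "\<exists>x\<in>B. q x \<le> count_list w x"
          proof (rule ccontr)
            assume "\<not> ?thesis"
            then have "(\<Sum>x\<in>B. count_list w x) \<le> ?D" by (intro sum_mono) auto
            then show False using sum_count_set[OF w(2) B(1)] True \<open>\<not> n \<le> ?D\<close> by simp
          qed
          then obtain x where x: "x \<in> B" "q x \<le> count_list w x" by blast
          define k where "k = count_list w x"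
          obtain r j where rj: "n = j + k" "r \<in> word_span B S (Suc j)"
            "y - (act x ^^ k) r \<in> word_span B S n"
            using collect_letter[OF B(2) w(1,2), of x] True w(4) unfolding k_def by auto
          define v where "v = (act x ^^ (k - q x)) r"
          have v: "(act x ^^ i) v \<in> L" if "i < q x" for i
          proof -
            have "(act x ^^ i) v \<in> word_span B S (Suc j + (k - q x) + i)"
              unfolding v_def by (intro act_power_word_span[OF B(2)] rj(2))
            moreover have "Suc j + (k - q x) + i \<le> n" using that x(2) rj(1) by (simp add: k_def)
            ultimately show ?thesis using word_span_mono Suc by blast
          qed
          have "E.powers_span (act x) (q x) v \<subseteq> L"
            using v by (intro E.span_minimal sub) auto
          then have "z x v - (act x ^^ q x) v \<in> L" using lead[OF x(1)] by blast
          moreover have "z x v \<in> L" using v[of 0] q[OF x(1)] L(1) x(1) by (simp add: E.stable_def)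
          ultimately have "z x v - (z x v - (act x ^^ q x) v) \<in> L" by (rule E.subspace_diff[OF sub, rotated])
          moreover have "(act x ^^ q x) v = (act x ^^ k) r"
            using funpow_add[of "q x" "k - q x" "act x"] x(2) by (simp add: v_def k_def)
          ultimately have "(act x ^^ k) r \<in> L" by simp
          moreover have "y - (act x ^^ k) r \<in> L" using rj(3) Suc by blast
          ultimately have "(y - (act x ^^ k) r) + (act x ^^ k) r \<in> L" by (intro E.subspace_add sub)
          then show ?thesis by simp
        qed
      qed
      then show ?thesis by (intro E.span_minimal sub)
    qed
  qed
  then show ?thesis using hull_subset_Union_word_span[OF B(2)] by blast
qed

section \<open>Essential extensions\<close>

text \<open>
  Otherwise, adding to a finite subset of \<open>W\<close> again and again an element of \<open>W\<close> outside the submodule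
  that it generates would give a strictly ascending chain.
\<close>

lemma noetherian_finitely_generated:
  assumes C: "E.noetherian Z C" and Z: "\<And>N. submodule N \<Longrightarrow> E.stable Z N"
    and W: "submodule W" "W \<subseteq> C"
  shows "finitely_generated W"
proof (rule ccontr)
  assume "\<not> finitely_generated W"
  then have neq: "submodule hull S \<noteq> W" if "finite S" for S
    using that by (auto simp: finitely_generated_def)
  have sub: "submodule hull S \<subseteq> W" if "S \<subseteq> W" for S using that W(1) by (rule hull_minimal)
  have "\<exists>x. x \<in> W \<and> x \<notin> submodule hull S" if "finite S" "S \<subseteq> W" for S
    using neq[OF that(1)] sub[OF that(2)] by blast
  then obtain pick where pick: "\<And>S. finite S \<Longrightarrow> S \<subseteq> W \<Longrightarrow> pick S \<in> W \<and> pick S \<notin> submodule hull S"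
    by metis
  define T where "T k = ((\<lambda>S. insert (pick S) S) ^^ k) {}" for k :: nat
  have T_Suc: "T (Suc k) = insert (pick (T k)) (T k)" for k by (simp add: T_def)
  have T: "finite (T k) \<and> T k \<subseteq> W" for k
  proof (induction k)
    case 0
    show ?case by (simp add: T_def)
  next
    case (Suc k)
    then show ?case using pick[of "T k"] by (simp add: T_Suc)
  qed
  have "\<exists>m. submodule hull T (Suc m) = submodule hull T m"
  proof (rule C[unfolded E.noetherian_def, rule_format, of "\<lambda>k. submodule hull T k"], intro conjI)
    fix k
    show "E.stable Z (submodule hull T k)" by (intro Z submodule_hull)
    show "submodule hull T k \<subseteq> C" using sub T W(2) by blast
    show "submodule hull T k \<subseteq> submodule hull T (Suc k)" by (intro hull_mono) (auto simp: T_Suc)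
  qed
  then obtain m where "submodule hull T (Suc m) = submodule hull T m" by blast
  moreover have "pick (T m) \<in> submodule hull T (Suc m)" by (intro hull_inc) (simp add: T_Suc)
  ultimately show False using pick[of "T m"] T by blast
qed

text \<open>
  This is where essentiality enters. Some monic polynomial \<open>t\<close> in \<open>z\<close> vanishes on the finite-dimensional
  \<open>C \<inter> M\<close>; a Fitting argument for the module endomorphism \<open>t\<close> shows that a power of \<open>t\<close> vanishes on all
  of \<open>C\<close>.
\<close>

lemma central_operator_algebraic:
  assumes M: "locally_finite M" "essential_extension UNIV M"
    and C: "submodule C" "E.noetherian Z C"
    and stable: "\<And>N. submodule N \<Longrightarrow> E.stable Z N"
    and Z: "\<And>z. z \<in> Z \<Longrightarrow> E.endomorphism z"
    and comm: "\<And>z z' x. z \<in> Z \<Longrightarrow> z' \<in> Z \<Longrightarrow> z (z' x) = z' (z x)"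
    and central: "\<And>z y x. z \<in> Z \<Longrightarrow> z (act y x) = act y (z x)"
    and z: "z \<in> Z"
  shows "\<exists>m. \<forall>x\<in>C. (z ^^ m) x \<in> E.powers_span z m x"
proof -
  have subM: "submodule M" and ess: "\<And>N. submodule N \<Longrightarrow> N \<inter> M = {0} \<Longrightarrow> N = {0}"
    using M(2) by (auto simp: essential_extension_def)
  have "submodule (C \<inter> M)"
    using C(1) subM by (auto simp: submodule_def intro: E.subspace_inter)
  moreover have "finitely_generated (C \<inter> M)"
    by (rule noetherian_finitely_generated[OF C(2) stable calculation]) auto
  ultimately have "E.finite_dim (C \<inter> M)" using M(1) by (simp add: locally_finite_def)
  then obtain B where B: "finite B" "E.span B = C \<inter> M" by (auto simp: E.finite_dim_def)
  have "E.stable Z (C \<inter> M)" using stable \<open>submodule (C \<inter> M)\<close> by blast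
  then have zW: "z x \<in> C \<inter> M" if "x \<in> C \<inter> M" for x using z that by (simp add: E.stable_def)
  have "(z ^^ i) b \<in> E.span B" if "b \<in> B" for i b
  proof (induction i)
    case 0
    show ?case using that by (simp add: E.span_base)
  next
    case (Suc i)
    then show ?case using zW unfolding B(2) by simp
  qed
  then obtain d c where dc: "\<And>b. b \<in> B \<Longrightarrow> (z ^^ d) b = (\<Sum>i<d. scaleE (c i) ((z ^^ i) b))"
    using E.common_dependence[OF B(1) B(1), of "\<lambda>i. z ^^ i"] by blast
  define t where "t = E.operator_poly (\<lambda>i. i) c d z"
  have t: "E.endomorphism t" unfolding t_def by (intro E.endomorphism_operator_poly Z z)
  have tn: "E.endomorphism (t ^^ n)" for n by (intro E.endomorphism_funpow t)
  have tW: "t x = 0" if "x \<in> C \<inter> M" for x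
  proof (rule EE.linear_eq_0_on_span[OF t])
    show "x \<in> E.span B" using that B(2) by simp
    show "t b = 0" if "b \<in> B" for b using dc[OF that] by (simp add: t_def E.operator_poly_def)
  qed
  have t_comm: "f (t x) = t (f x)"
    if "E.endomorphism f" "\<And>x. f (z x) = z (f x)" for f x
    unfolding t_def using that by (rule E.operator_poly_commute)
  have tn_comm: "f ((t ^^ n) x) = (t ^^ n) (f x)"
    if "E.endomorphism f" "\<And>x. f (z x) = z (f x)" for f n x
    by (induction n) (simp_all add: t_comm[OF that])
  have "E.stable Z C" using stable C(1) by blast
  then have zC: "z' x \<in> C" if "z' \<in> Z" "x \<in> C" for z' x using that by (simp add: E.stable_def)
  have tC: "(t ^^ n) x \<in> C" if "x \<in> C" for x n
  proof (induction n)
    case 0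
    show ?case using that by simp
  next
    case (Suc n)
    then show ?case unfolding t_def
      using E.operator_poly_mem[OF submoduleD(1)[OF C(1)] zC[OF z]] by simp
  qed
  define K where "K n = {x \<in> C. (t ^^ n) x = 0}" for n
  (* The kernels are stable under all of Z, because Z commutes with t, so the chain condition applies. *)
  have "\<exists>n. K (Suc n) = K n"
  proof (rule C(2)[unfolded E.noetherian_def, rule_format, of K], intro conjI)
    fix n
    show "K n \<subseteq> C" by (auto simp: K_def)
    show "K n \<subseteq> K (Suc n)" by (auto simp: K_def EE.linear_0[OF t])
    have "E.subspace (K n)"
      using submoduleD(1)[OF C(1)] by (auto simp: K_def E.subspace_def EE.linear_0[OF tn]
          EE.linear_add[OF tn] EE.linear_scale[OF tn])
    moreover have "z' x \<in> K n" if "z' \<in> Z" "x \<in> K n" for z' x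
      using that zC tn_comm[OF Z[OF that(1)] comm[OF that(1) z], of n x]
      by (simp add: K_def EE.linear_0[OF Z[OF that(1)]])
    ultimately show "E.stable Z (K n)" by (simp add: E.stable_def)
  qed
  then obtain n where n: "K (Suc n) = K n" by blast
  have image: "submodule ((t ^^ n) ` C)"
    unfolding submodule_def
  proof (intro conjI allI ballI)
    show "E.subspace ((t ^^ n) ` C)" using EE.linear_subspace_image[OF tn submoduleD(1)[OF C(1)]] .
    fix y m assume "m \<in> (t ^^ n) ` C"
    then obtain x where x: "x \<in> C" "m = (t ^^ n) x" by blast
    have "act y m = (t ^^ n) (act y x)"
      unfolding x(2) by (rule tn_comm[OF linear_act_right]) (simp add: central[OF z])
    then show "act y m \<in> (t ^^ n) ` C" using submoduleD(2)[OF C(1) x(1)] by blast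
  qed
  have "(t ^^ n) x = 0" if "x \<in> C" "(t ^^ n) x \<in> M" for x
  proof -
    have "t ((t ^^ n) x) = 0" using that tC tW by blast
    then have "x \<in> K (Suc n)" using that by (simp add: K_def)
    then show ?thesis unfolding n by (simp add: K_def)
  qed
  then have "(t ^^ n) ` C \<inter> M = {0}"
    using E.subspace_0[OF submoduleD(1)[OF image]] E.subspace_0[OF submoduleD(1)[OF subM]] by auto
  then have zero: "(t ^^ n) x = 0" if "x \<in> C" for x using ess[OF image] that by blast
  have "(z ^^ (d * n)) x \<in> E.powers_span z (d * n) x" if "x \<in> C" for x
  proof -
    have "t y - (z ^^ d) y \<in> E.powers_span z d y" for y
      unfolding t_def using E.operator_poly_leading[of "\<lambda>i. i"] by (simp add: strict_mono_def)
    from E.leading_funpow[OF t this, of n x] have "- (z ^^ (d * n)) x \<in> E.powers_span z (d * n) x"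
      by (simp add: zero[OF that])
    then show ?thesis using E.span_neg by fastforce
  qed
  then show ?thesis by blast
qed

lemma locally_finite_of_essential:
  assumes p: "prime CHAR('k)" and fin: "A.finite_dim UNIV"
    and M: "locally_finite M" "essential_extension UNIV M"
  shows "locally_finite UNIV"
  unfolding locally_finite_def
proof (intro allI impI, elim conjE)
  fix C assume "submodule C" "finitely_generated C"
  then obtain S where S: "finite S" "C = submodule hull S" by (auto simp: finitely_generated_def)
  obtain B where B: "finite B" "A.span B = UNIV" using fin by (auto simp: A.finite_dim_def)
  define p where "p = CHAR('k)"
  have p: "prime p" "CHAR('k) = p" using assms(1) by (simp_all add: p_def)
  have e: "strict_mono ((^) p)" using prime_gt_1_nat[OF p(1)] by (simp add: strict_mono_def)
  obtain m c where central: "\<And>x y u. E.operator_poly ((^) p) (c x) (m x) (act x) (act y u)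
      = act y (E.operator_poly ((^) p) (c x) (m x) (act x) u)"
    using central_polynomial[OF p B] by metis
  define z where "z x = E.operator_poly ((^) p) (c x) (m x) (act x)" for x
  have z: "E.endomorphism (z x)" for x
    unfolding z_def by (intro E.endomorphism_operator_poly linear_act_right)
  have z_act: "z x (act y u) = act y (z x u)" for x y u unfolding z_def by (rule central)
  have z_comm: "z x (z y u) = z y (z x u)" for x y u
    unfolding z_def[of y] by (intro E.operator_poly_commute z z_act)
  have stable: "E.stable (z ` B) N" if "submodule N" for N
    unfolding E.stable_def
  proof (intro conjI ballI)
    show "E.subspace N" using that by (rule submoduleD)
    fix f u assume "f \<in> z ` B" and u: "u \<in> N"
    then obtain x where f: "f = z x" by blast
    show "f u \<in> N"
      unfolding f z_def by (rule E.operator_poly_mem[OF submoduleD[OF that] u])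
  qed
  (* The degree of z x in act x is p ^ m x, which fixes the length bound. *)
  define W where "W = words B S (Suc (\<Sum>x\<in>B. p ^ m x))"
  have W: "finite W" unfolding W_def by (intro finite_words B S)
  have generated: "C \<subseteq> L" if "E.stable (z ` B) L" "E.span W \<subseteq> L" for L
    unfolding S(2)
  proof (rule hull_subset_of_stable[where z = z and q = "\<lambda>x. p ^ m x", OF B _ _ that(1)])
    show "0 < p ^ m x" for x using prime_gt_0_nat[OF p(1)] by simp
    show "z x u - (act x ^^ (p ^ m x)) u \<in> E.powers_span (act x) (p ^ m x) u" for x u
      unfolding z_def by (rule E.operator_poly_leading[OF e])
    show "word_span B S (Suc (\<Sum>x\<in>B. p ^ m x)) \<subseteq> L" using that(2) by (simp add: W_def)
  qed
  have Zfin: "finite (z ` B)" using B(1) by simp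
  have Zend: "\<And>f. f \<in> z ` B \<Longrightarrow> E.endomorphism f" using z by blast
  have Zcomm: "\<And>f g x. f \<in> z ` B \<Longrightarrow> g \<in> z ` B \<Longrightarrow> f (g x) = g (f x)" using z_comm by blast
  have "\<exists>H. E.span W \<subseteq> H \<and> E.stable (z ` B) H \<and> E.noetherian (z ` B) H"
    by (rule E.noetherian_stable_superset) (fact Zfin Zend Zcomm W)+
  then obtain H where H: "E.span W \<subseteq> H" "E.stable (z ` B) H" "E.noetherian (z ` B) H"
    by blast
  have C: "E.noetherian (z ` B) C"
    using E.noetherian_subset[OF H(3) generated[OF H(2,1)]] .
  have Zact: "\<And>f y u. f \<in> z ` B \<Longrightarrow> f (act y u) = act y (f u)" using z_act by blast
  have alg: "\<exists>k. \<forall>x\<in>C. (f ^^ k) x \<in> E.powers_span f k x" if "f \<in> z ` B" for f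
    by (rule central_operator_algebraic)
      (fact M \<open>submodule C\<close> C stable Zend Zcomm Zact that)+
  have WC: "W \<subseteq> C"
    unfolding W_def S(2) by (rule words_subset_submodule[OF submodule_hull hull_subset])
  have "\<exists>F. finite F \<and> F \<subseteq> C \<and> E.span W \<subseteq> E.span F \<and> E.stable (z ` B) (E.span F)"
    by (rule E.finite_dim_stable_superset)
      (fact Zfin Zend Zcomm W WC stable[OF \<open>submodule C\<close>] alg)+
  then obtain F where F: "finite F" "F \<subseteq> C" "E.span W \<subseteq> E.span F" "E.stable (z ` B) (E.span F)"
    by blast
  have "E.span F = C"
    using generated[OF F(4,3)] E.span_minimal[OF F(2) submoduleD(1)[OF \<open>submodule C\<close>]] by blast
  then show "E.finite_dim C" using F(1) by (auto simp: E.finite_dim_def)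
qed

end

theorem theorem2p1:
  fixes scaleA :: "'k::field \<Rightarrow> 'a::ab_group_add \<Rightarrow> 'a"
    and bracket :: "'a \<Rightarrow> 'a \<Rightarrow> 'a"
    and scaleE :: "'k \<Rightarrow> 'e::ab_group_add \<Rightarrow> 'e"
    and act :: "'a \<Rightarrow> 'e \<Rightarrow> 'e"
    and M :: "'e set"
  assumes "prime CHAR('k)"
    and "lie_algebra scaleA bracket"
    and "vector_space.finite_dim scaleA UNIV"
    and "lie_module scaleA bracket scaleE act"
    and "lie_module.locally_finite scaleE act M"
    and "lie_module.essential_extension scaleE act UNIV M"
  shows "lie_module.locally_finite scaleE act UNIV"
proof -
  interpret lie_module scaleA bracket scaleE act by fact
  show ?thesis by (rule locally_finite_of_essential[OF assms(1,3,5,6)])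
qed

end
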